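(* Let $n\ge2$ with $n\equiv 2$ or $3\pmod 4$. Then the number of equiparity Latin squares in the ensemble of any $\mathrm{OA}(n+1,n)$ is congruent to $\lceil n/4\rceil$ modulo $4$.
   Context: An orthogonal array $\mathrm{OA}(k,n)$ on an alphabet $\Lambda$ with $|\Lambda|=n$ is an $n^2\times k$ matrix $A=(a_{r\ell})$ with entries in $\Lambda$ such that in every pair of distinct columns each ordered pair in $\Lambda^2$ occurs in exactly one row. The ensemble of $A$ is the family of Latin squares indexed by the $\binom{k}{3}$ choices of columns $i<j<\ell$ of $A$ (Latin squares are counted once for each choice of three columns): the Latin square for $i<j<\ell$ has rows and columns indexed by $\Lambda$, and for each row $r$ of $A$ its entry in row $a_{ri}$, column $a_{rj}$ is $a_{r\ell}$. For a Latin square $L=(l_{xy})$ with rows, columns and symbols indexed by $\Lambda$, the row-parity $\pi_r\in\mathbb{Z}_2$ is the sum of the parities ($0$ even, $1$ odd) of the $n$ permutations $y\mapsto l_{xy}$ ($x\in\Lambda$ fixed); the column-parity $\pi_c$ is the sum of the parities of the $n$ permutations $x\mapsto l_{xy}$ ($y$ fixed); the symbol-parity $\pi_s$ is the sum of the parities of the $n$ permutations mapping $x\mapsto y$ whenever $l_{xy}=s$ ($s$ fixed). $L$ is equiparity if $\pi_r=\pi_c=\pi_s$. *)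

theory Defs
  imports
    "HOL-Combinatorics.Combinatorics"
    "HOL-Library.Z2"
    "HOL-Number_Theory.Cong"
    "Jordan_Normal_Form.Matrix"
begin

text \<open>Rows and columns of the matrix are numbered from 0, following the library.\<close>

definition orthogonal_array :: "nat \<Rightarrow> nat \<Rightarrow> 'a set \<Rightarrow> 'a mat \<Rightarrow> bool" where
  "orthogonal_array k n \<Lambda> A \<longleftrightarrow>
     finite \<Lambda> \<and> card \<Lambda> = n \<and>
     A \<in> carrier_mat (n\<^sup>2) k \<and>
     (\<forall>r < n\<^sup>2. \<forall>l < k. A $$ (r, l) \<in> \<Lambda>) \<and>
     (\<forall>i < k. \<forall>j < k. i \<noteq> j \<longrightarrow>
        (\<forall>x \<in> \<Lambda>. \<forall>y \<in> \<Lambda>. \<exists>!r. r < n\<^sup>2 \<and> A $$ (r, i) = x \<and> A $$ (r, j) = y))"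

text \<open>
  A square with rows, columns and symbols indexed by \<open>\<Lambda>\<close> is a binary function on the
  underlying type; its values outside \<open>\<Lambda>\<close> are irrelevant.
\<close>

definition latin_square :: "'a set \<Rightarrow> ('a \<Rightarrow> 'a \<Rightarrow> 'a) \<Rightarrow> bool" where
  "latin_square \<Lambda> L \<longleftrightarrow>
     (\<forall>x \<in> \<Lambda>. bij_betw (\<lambda>y. L x y) \<Lambda> \<Lambda>) \<and>
     (\<forall>y \<in> \<Lambda>. bij_betw (\<lambda>x. L x y) \<Lambda> \<Lambda>)"

text \<open>The member of the ensemble of \<open>A\<close> given by the columns \<open>i\<close>, \<open>j\<close>, \<open>l\<close>.\<close>

definition ensemble_square :: "'a mat \<Rightarrow> nat \<Rightarrow> nat \<Rightarrow> nat \<Rightarrow> 'a \<Rightarrow> 'a \<Rightarrow> 'a" where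
  "ensemble_square A i j l x y =
     A $$ (THE r. r < dim_row A \<and> A $$ (r, i) = x \<and> A $$ (r, j) = y, l)"

text \<open>
  The parity, in the two-element field, of a map that permutes \<open>\<Lambda>\<close>. The library's
  \<open>evenperm\<close> is meaningful only for permutations of the whole type with finite support,
  so the map is first made to be the identity outside \<open>\<Lambda>\<close>.
\<close>

definition parity_on :: "'a set \<Rightarrow> ('a \<Rightarrow> 'a) \<Rightarrow> bit" where
  "parity_on \<Lambda> f = (if evenperm (perm_restrict f \<Lambda>) then 0 else 1)"

definition row_parity :: "'a set \<Rightarrow> ('a \<Rightarrow> 'a \<Rightarrow> 'a) \<Rightarrow> bit" where
  "row_parity \<Lambda> L = (\<Sum>x\<in>\<Lambda>. parity_on \<Lambda> (\<lambda>y. L x y))"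

definition column_parity :: "'a set \<Rightarrow> ('a \<Rightarrow> 'a \<Rightarrow> 'a) \<Rightarrow> bit" where
  "column_parity \<Lambda> L = (\<Sum>y\<in>\<Lambda>. parity_on \<Lambda> (\<lambda>x. L x y))"

definition symbol_parity :: "'a set \<Rightarrow> ('a \<Rightarrow> 'a \<Rightarrow> 'a) \<Rightarrow> bit" where
  "symbol_parity \<Lambda> L = (\<Sum>s\<in>\<Lambda>. parity_on \<Lambda> (\<lambda>x. THE y. y \<in> \<Lambda> \<and> L x y = s))"

definition equiparity :: "'a set \<Rightarrow> ('a \<Rightarrow> 'a \<Rightarrow> 'a) \<Rightarrow> bool" where
  "equiparity \<Lambda> L \<longleftrightarrow>
     row_parity \<Lambda> L = column_parity \<Lambda> L \<and> column_parity \<Lambda> L = symbol_parity \<Lambda> L"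

lemma ensemble_square_row:
  assumes A: "orthogonal_array k n \<Lambda> A"
    and ij: "i < k" "j < k" "i \<noteq> j" and r: "r < n\<^sup>2"
  shows "ensemble_square A i j l (A $$ (r, i)) (A $$ (r, j)) = A $$ (r, l)"
proof -
  have d: "dim_row A = n\<^sup>2" using A by (auto simp: orthogonal_array_def)
  have "\<exists>!q. q < n\<^sup>2 \<and> A $$ (q, i) = A $$ (r, i) \<and> A $$ (q, j) = A $$ (r, j)"
    using A ij r by (simp add: orthogonal_array_def)
  then have "(THE q. q < n\<^sup>2 \<and> A $$ (q, i) = A $$ (r, i) \<and> A $$ (q, j) = A $$ (r, j)) = r"
    using r by (intro the1_equality) auto
  then show ?thesis by (simp add: ensemble_square_def d)
qed

lemma latin_square_ensemble_square:
  assumes A: "orthogonal_array k n \<Lambda> A"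
    and ijl: "i < k" "j < k" "l < k" "i \<noteq> j" "i \<noteq> l" "j \<noteq> l"
  shows "latin_square \<Lambda> (ensemble_square A i j l)"
proof -
  let ?L = "ensemble_square A i j l"
  have fin: "finite \<Lambda>" using A by (simp add: orthogonal_array_def)
  have ex: "\<exists>r < n\<^sup>2. A $$ (r, p) = u \<and> A $$ (r, q) = v"
    if "p < k" "q < k" "p \<noteq> q" "u \<in> \<Lambda>" "v \<in> \<Lambda>" for p q u v
    using A that unfolding orthogonal_array_def by blast
  have mem: "A $$ (r, p) \<in> \<Lambda>" if "r < n\<^sup>2" "p < k" for r p
    using A that by (simp add: orthogonal_array_def)
  have L: "?L (A $$ (r, i)) (A $$ (r, j)) = A $$ (r, l)" if "r < n\<^sup>2" for r
    using ensemble_square_row[OF A] ijl that by blast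
  have cl: "?L x y \<in> \<Lambda>" if "x \<in> \<Lambda>" "y \<in> \<Lambda>" for x y
    using ex[of i j x y] ijl that L mem by metis
  have onto_row: "\<exists>y \<in> \<Lambda>. ?L x y = s" if "x \<in> \<Lambda>" "s \<in> \<Lambda>" for x s
    using ex[of i l x s] ijl that L mem by metis
  have onto_col: "\<exists>x \<in> \<Lambda>. ?L x y = s" if "y \<in> \<Lambda>" "s \<in> \<Lambda>" for y s
    using ex[of j l y s] ijl that L mem by metis
  have "bij_betw f \<Lambda> \<Lambda>" if "f ` \<Lambda> = \<Lambda>" for f :: "'a \<Rightarrow> 'a"
    using fin that by (simp add: bij_betw_def finite_surj_inj)
  moreover have "(\<lambda>y. ?L x y) ` \<Lambda> = \<Lambda>" if "x \<in> \<Lambda>" for x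
    using cl onto_row that by (fastforce simp: image_iff)
  moreover have "(\<lambda>x. ?L x y) ` \<Lambda> = \<Lambda>" if "y \<in> \<Lambda>" for y
    using cl onto_col that by (fastforce simp: image_iff)
  ultimately show ?thesis by (simp add: latin_square_def)
qed

end

theory Submission
  imports Defs
begin

text \<open>
  Label the symbols by \<open>0, \<dots>, n - 1\<close>. Say that column \<open>i\<close> beats column \<open>j\<close> if the permutation sorting
  the rows lexicographically by columns \<open>i\<close>, \<open>j\<close> is odd. For a pair of columns \<open>i\<close>, \<open>j\<close> the permutations
  with \<open>c\<close> fixed have total parity \<open>beats c i + beats c j\<close>, so a triple of columns is equiparity according
  to its pattern of beats. As \<open>n choose 2\<close> is odd, beating is a tournament on the \<open>n + 1\<close> columns, and the
  equiparity triples are exactly its cyclic triples. Their number is a function of the sum of the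
  squares of the scores. Any two rows agree in exactly one column; counting the inversions of two
  columns \<open>c\<close>, \<open>c'\<close> according to that column shows that all scores have the same parity, which
  determines the sum of squares modulo 8 and hence the number of cyclic triples modulo 4.
\<close>

section \<open>Inversions\<close>

text \<open>Two keys on an arbitrary set, instead of one permutation, so that permutations of the
  alphabet and orderings of the rows of the array are treated alike. Pairs tied in either key do not
  count.\<close>

definition inversions :: "'b set \<Rightarrow> ('b \<Rightarrow> nat) \<Rightarrow> ('b \<Rightarrow> nat) \<Rightarrow> ('b \<times> 'b) set" where
  "inversions X u v = {(p, q) \<in> X \<times> X. u p < u q \<and> v q < v p}"

lemma finite_inversions [simp]: "finite X \<Longrightarrow> finite (inversions X u v)"
  unfolding inversions_def by (rule finite_subset[of _ "X \<times> X"]) auto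

lemma inversions_cong:
  assumes "\<And>p. p \<in> X \<Longrightarrow> u p = u' p" "\<And>p. p \<in> X \<Longrightarrow> v p = v' p"
  shows "inversions X u v = inversions X u' v'"
  using assms by (auto simp: inversions_def)

lemma card_inversions_reindex:
  assumes "bij_betw g Y X"
  shows "card (inversions X u v) = card (inversions Y (u \<circ> g) (v \<circ> g))"
proof -
  have "bij_betw (map_prod g g) (inversions Y (u \<circ> g) (v \<circ> g)) (inversions X u v)"
    using assms by (fastforce simp: bij_betw_def inj_on_def inversions_def image_iff)
  then show ?thesis by (simp add: bij_betw_same_card)
qed

lemma card_Collect_split:
  assumes "finite X"
  shows "card {x \<in> X. P x} = card {x \<in> X. P x \<and> Q x} + card {x \<in> X. P x \<and> \<not> Q x}"
proof -
  have "{x \<in> X. P x} = {x \<in> X. P x \<and> Q x} \<union> {x \<in> X. P x \<and> \<not> Q x}" by auto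
  also have "card \<dots> = card {x \<in> X. P x \<and> Q x} + card {x \<in> X. P x \<and> \<not> Q x}"
    using assms by (intro card_Un_disjoint) auto
  finally show ?thesis .
qed

lemma even_card_symdiff:
  assumes "finite X"
  shows "even (card {x \<in> X. P x \<noteq> Q x}) \<longleftrightarrow>
         (even (card {x \<in> X. P x}) \<longleftrightarrow> even (card {x \<in> X. Q x}))"
proof -
  have "{x \<in> X. P x \<noteq> Q x \<and> P x} = {x \<in> X. P x \<and> \<not> Q x}"
    "{x \<in> X. P x \<noteq> Q x \<and> \<not> P x} = {x \<in> X. Q x \<and> \<not> P x}"
    "{x \<in> X. Q x \<and> P x} = {x \<in> X. P x \<and> Q x}" by auto
  then show ?thesis
    using card_Collect_split[OF assms, of P Q] card_Collect_split[OF assms, of Q P]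
      card_Collect_split[OF assms, of "\<lambda>x. P x \<noteq> Q x" P] by auto
qed

text \<open>For a pair ordered by \<open>u\<close>, the order of \<open>w\<close> disagrees with that of \<open>v\<close> iff exactly one of
  \<open>v\<close> and \<open>w\<close> disagrees with \<open>u\<close>.\<close>

lemma even_card_inversions_trans:
  assumes X: "finite X" and inj: "inj_on u X" "inj_on v X" "inj_on w X"
  shows "even (card (inversions X v w)) \<longleftrightarrow>
         (even (card (inversions X u v)) \<longleftrightarrow> even (card (inversions X u w)))"
proof -
  define M where "M = {(p, q) \<in> X \<times> X. u p < u q}"
  have fin: "finite M"
    unfolding M_def using X by (auto intro: finite_subset[of _ "X \<times> X"])
  define P where "P = (\<lambda>(p, q). v q < v p)"
  define Q where "Q = (\<lambda>(p, q). w q < w p)"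
  have ne: "u p \<noteq> u q" "v p \<noteq> v q" "w p \<noteq> w q" if "p \<in> X" "q \<in> X" "p \<noteq> q" for p q
    using inj that by (auto dest: inj_onD)
  \<comment> \<open>An inversion of \<open>v\<close> and \<open>w\<close> is oriented by
    \<open>v\<close>; reorienting it by \<open>u\<close> places all three comparisons on the single
    set \<open>M\<close>.\<close>
  have "bij_betw (\<lambda>(p, q). if u p < u q then (p, q) else (q, p))
      (inversions X v w) {z \<in> M. P z \<noteq> Q z}"
  proof (rule bij_betw_byWitness[where f' = "\<lambda>(p, q). if v p < v q then (p, q) else (q, p)"])
    show "(\<lambda>(p, q). if u p < u q then (p, q) else (q, p)) ` inversions X v w \<subseteq> {z \<in> M. P z \<noteq> Q z}"
    proof (intro image_subsetI, split prod.split, intro allI impI)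
      fix z p q assume "z \<in> inversions X v w" "z = (p, q)"
      then have "p \<in> X" "q \<in> X" "v p < v q" "w q < w p" by (auto simp: inversions_def)
      moreover from this have "u p \<noteq> u q" using ne(1)[of p q] by auto
      ultimately show "(if u p < u q then (p, q) else (q, p)) \<in> {z \<in> M. P z \<noteq> Q z}"
        by (auto simp: M_def P_def Q_def)
    qed
    show "(\<lambda>(p, q). if v p < v q then (p, q) else (q, p)) ` {z \<in> M. P z \<noteq> Q z} \<subseteq> inversions X v w"
    proof (intro image_subsetI, split prod.split, intro allI impI)
      fix z p q assume "z \<in> {z \<in> M. P z \<noteq> Q z}" "z = (p, q)"
      then have pq: "(p, q) \<in> M" and PQ: "P (p, q) \<noteq> Q (p, q)" by auto
      from pq have "p \<in> X" "q \<in> X" "p \<noteq> q" by (auto simp: M_def)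
      with PQ ne[of p q] show "(if v p < v q then (p, q) else (q, p)) \<in> inversions X v w"
        by (auto simp: inversions_def P_def Q_def)
    qed
  qed (auto simp: inversions_def M_def split: prod.splits if_splits)
  then have "card (inversions X v w) = card {z \<in> M. P z \<noteq> Q z}"
    by (rule bij_betw_same_card)
  moreover have "inversions X u v = {z \<in> M. P z}" "inversions X u w = {z \<in> M. Q z}"
    by (auto simp: inversions_def M_def P_def Q_def)
  ultimately show ?thesis using even_card_symdiff[OF fin] by simp
qed

section \<open>The sign of a permutation as the parity of its inversions\<close>

lemma odd_card_inversions_transpose:
  assumes S: "finite S" and e: "inj_on e S" and ab: "a \<in> S" "b \<in> S" "e a < e b"
  shows "odd (card (inversions S e (e \<circ> transpose a b)))"
proof -
  define Z where "Z = {z \<in> S. e a < e z \<and> e z < e b}"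
  have finZ: "finite Z" using S by (simp add: Z_def)
  \<comment> \<open>Besides \<open>(a, b)\<close> itself, every \<open>z\<close> labelled strictly
    between \<open>a\<close> and \<open>b\<close> contributes exactly the two pairs
    \<open>(a, z)\<close> and \<open>(z, b)\<close>.\<close>
  have "inversions S e (e \<circ> transpose a b) = insert (a, b) ({a} \<times> Z \<union> Z \<times> {b})"
    (is "?I = ?J")
  proof (intro subset_antisym subsetI)
    fix z assume "z \<in> ?I"
    then show "z \<in> ?J"
      using ab by (auto simp: inversions_def Z_def transpose_def split: if_splits)
  next
    fix z assume "z \<in> ?J"
    then show "z \<in> ?I"
      using ab by (auto simp: inversions_def Z_def transpose_def split: if_splits)
  qed
  moreover have "card ({a} \<times> Z \<union> Z \<times> {b}) = card Z + card Z"
    using finZ by (subst card_Un_disjoint) (auto simp: Z_def card_cartesian_product)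
  moreover have "(a, b) \<notin> {a} \<times> Z \<union> Z \<times> {b}" by (auto simp: Z_def)
  ultimately show ?thesis using finZ by simp
qed

text \<open>Composing with a transposition flips both sides. The labelling \<open>e\<close> supplies
  the linear order that the alphabet itself need not have.\<close>

lemma evenperm_iff_even_inversions:
  assumes "f permutes S" "finite S" "inj_on e S"
  shows "evenperm f \<longleftrightarrow> even (card (inversions S e (e \<circ> f)))"
  using assms
proof (induction rule: permutes_induct)
  case id
  have "inversions S e e = {}" by (auto simp: inversions_def)
  then show ?case by simp
next
  case (swap a b p)
  let ?t = "transpose a b"
  have t: "?t permutes S" using swap by (simp add: permutes_swap_id)
  have tp: "?t \<circ> p permutes S" using permutes_compose[OF swap.hyps(4) t] .
  have inj: "inj_on (e \<circ> f) S" if "f permutes S" for f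
    using that swap.prems by (intro comp_inj_on) (auto simp: permutes_inj_on permutes_image)
  have odd_t: "odd (card (inversions S e (e \<circ> ?t)))"
  proof (cases "e a < e b")
    case True
    then show ?thesis
      using odd_card_inversions_transpose[OF assms(2) swap.prems(1) swap.hyps(1,2)] by simp
  next
    case False
    then have "e b < e a" using swap.prems(1) swap.hyps(1-3) by (meson inj_onD linorder_neqE_nat)
    then show ?thesis
      using odd_card_inversions_transpose[OF assms(2) swap.prems(1) swap.hyps(2,1)]
      by (simp add: transpose_commute)
  qed
  \<comment> \<open>Reindexing along \<open>p\<close> turns the odd inversion count of the
    transposition into the comparison of \<open>e \<circ> p\<close> with
    \<open>e \<circ> (?t \<circ> p)\<close>, which the transitivity law relates to the inversion
    counts of \<open>p\<close> and of \<open>?t \<circ> p\<close>.\<close>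
  moreover have "card (inversions S e (e \<circ> ?t)) =
      card (inversions S (e \<circ> p) (e \<circ> (?t \<circ> p)))"
    using card_inversions_reindex[OF permutes_imp_bij[OF swap.hyps(4)], of e "e \<circ> ?t"]
    by (simp only: comp_assoc)
  moreover have "permutation ?t" "permutation p"
    using permutes_imp_permutation assms(2) t swap.hyps(4) by blast+
  moreover have "evenperm (?t \<circ> p) \<longleftrightarrow> \<not> evenperm p"
    using calculation swap.hyps(3) by (simp add: evenperm_comp evenperm_swap)
  ultimately show ?case
    using odd_t swap.IH[OF swap.prems]
      even_card_inversions_trans[OF assms(2) swap.prems inj[OF swap.hyps(4)] inj[OF tp]] by metis
qed

lemma of_nat_bit: "(of_nat a :: bit) = (if even a then 0 else 1)"
  by (induction a) auto

lemma parity_on_eq_inversions: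
  assumes "finite \<Lambda>" "inj_on e \<Lambda>" "bij_betw f \<Lambda> \<Lambda>"
  shows "parity_on \<Lambda> f = of_nat (card (inversions \<Lambda> e (e \<circ> f)))"
proof -
  have "bij_betw (perm_restrict f \<Lambda>) \<Lambda> \<Lambda>"
    using assms(3) by (rule bij_betw_cong[THEN iffD1, rotated]) (simp add: perm_restrict_simps)
  then have "perm_restrict f \<Lambda> permutes \<Lambda>"
    by (rule bij_imp_permutes) (simp add: perm_restrict_simps)
  moreover have "inversions \<Lambda> e (e \<circ> perm_restrict f \<Lambda>) = inversions \<Lambda> e (e \<circ> f)"
    by (rule inversions_cong) (auto simp: perm_restrict_simps)
  ultimately have "evenperm (perm_restrict f \<Lambda>) \<longleftrightarrow> even (card (inversions \<Lambda> e (e \<circ> f)))"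
    using evenperm_iff_even_inversions assms by metis
  then show ?thesis by (simp add: parity_on_def of_nat_bit)
qed

text \<open>Blocks are the level sets of \<open>g\<close>. With columns of an array as
  \<open>g\<close>, \<open>u\<close>, \<open>v\<close>, this gathers the inversions of all
  permutations that enter one of the three parities of a Latin square.\<close>

definition block_inversions ::
    "'b set \<Rightarrow> ('b \<Rightarrow> 'c) \<Rightarrow> ('b \<Rightarrow> nat) \<Rightarrow> ('b \<Rightarrow> nat) \<Rightarrow> ('b \<times> 'b) set" where
  "block_inversions X g u v = {(p, q) \<in> X \<times> X. g p = g q \<and> u p < u q \<and> v q < v p}"

lemma finite_block_inversions [simp]: "finite X \<Longrightarrow> finite (block_inversions X g u v)"
  unfolding block_inversions_def by (rule finite_subset[of _ "X \<times> X"]) auto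

lemma card_block_inversions:
  assumes "finite X" "finite G" "g ` X \<subseteq> G"
  shows "card (block_inversions X g u v) = (\<Sum>x\<in>G. card (inversions {p \<in> X. g p = x} u v))"
proof -
  have "block_inversions X g u v = (\<Union>x\<in>G. inversions {p \<in> X. g p = x} u v)"
    using assms(3) by (auto simp: block_inversions_def inversions_def)
  moreover have "card \<dots> = (\<Sum>x\<in>G. card (inversions {p \<in> X. g p = x} u v))"
  proof (rule card_UN_disjoint)
    show "\<forall>x\<in>G. \<forall>y\<in>G. x \<noteq> y \<longrightarrow>
        inversions {p \<in> X. g p = x} u v \<inter> inversions {p \<in> X. g p = y} u v = {}"
      by (auto simp: inversions_def)
  qed (use assms in auto)
  ultimately show ?thesis by simp
qed

section \<open>Counting in tournaments\<close>

text \<open>Orienting each pair so that its member satisfying \<open>Q\<close> comes first yields a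
  full product set.\<close>

lemma card_mixed_pairs:
  fixes V :: "nat set"
  assumes "finite V"
  shows "card {(i, j) \<in> V \<times> V. i < j \<and> Q i \<noteq> Q j} = card {i \<in> V. Q i} * card {i \<in> V. \<not> Q i}"
proof -
  have "bij_betw (\<lambda>(i, j). if Q i then (i, j) else (j, i))
      {(i, j) \<in> V \<times> V. i < j \<and> Q i \<noteq> Q j} ({i \<in> V. Q i} \<times> {i \<in> V. \<not> Q i})"
    by (rule bij_betw_byWitness[where f' = "\<lambda>(i, j). if i < j then (i, j) else (j, i)"])
      (auto split: if_splits, (metis linorder_neqE_nat)+)
  then show ?thesis by (simp add: bij_betw_same_card card_cartesian_product)
qed

lemma card_increasing_pairs:
  fixes V :: "nat set"
  assumes "finite V"
  shows "2 * card {(i, j) \<in> V \<times> V. i < j} + card V = card V * card V"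
proof -
  have fin: "finite {(i, j) \<in> V \<times> V. R i j}" for R
    using assms by (auto intro: finite_subset[of _ "V \<times> V"])
  have "bij_betw prod.swap {(i, j) \<in> V \<times> V. i < j} {(i, j) \<in> V \<times> V. j < i}"
    by (rule bij_betw_byWitness[where f' = prod.swap]) auto
  then have 1: "card {(i, j) \<in> V \<times> V. i < j} = card {(i, j) \<in> V \<times> V. j < i}"
    by (rule bij_betw_same_card)
  have "bij_betw (\<lambda>i. (i, i)) V {(i, j) \<in> V \<times> V. i = j}"
    by (rule bij_betw_byWitness[where f' = fst]) auto
  then have 2: "card V = card {(i, j) \<in> V \<times> V. i = j}"
    by (rule bij_betw_same_card)
  have "V \<times> V = ({(i, j) \<in> V \<times> V. i < j} \<union> {(i, j) \<in> V \<times> V. j < i}) \<union> {(i, j) \<in> V \<times> V. i = j}"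
    by auto
  also have "card \<dots> = card ({(i, j) \<in> V \<times> V. i < j} \<union> {(i, j) \<in> V \<times> V. j < i})
      + card {(i, j) \<in> V \<times> V. i = j}"
    using fin by (intro card_Un_disjoint finite_UnI) auto
  also have "card ({(i, j) \<in> V \<times> V. i < j} \<union> {(i, j) \<in> V \<times> V. j < i}) =
      card {(i, j) \<in> V \<times> V. i < j} + card {(i, j) \<in> V \<times> V. j < i}"
    using fin by (intro card_Un_disjoint) auto
  finally show ?thesis using 1 2 by (simp add: card_cartesian_product)
qed

section \<open>Triples with a marked member, and cyclic triples of a tournament\<close>

definition triples :: "nat \<Rightarrow> (nat \<times> nat \<times> nat) set" where
  "triples N = {(i, j, l). i < j \<and> j < l \<and> l < N}"

lemma finite_triples [simp]: "finite (triples N)"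
  unfolding triples_def by (rule finite_subset[of _ "{..<N} \<times> {..<N} \<times> {..<N}"]) auto

text \<open>Double counting: a point together with a pair of other points is a triple with one
  marked member, which is its smallest, middle or largest (\<open>P1\<close>, \<open>P2\<close>,
  \<open>P3\<close>).\<close>

lemma sum_pointed_pairs:
  fixes g :: "nat \<Rightarrow> nat \<Rightarrow> nat \<Rightarrow> nat"
  shows "(\<Sum>c<N. \<Sum>(i, j)\<in>{(i, j) \<in> ({..<N} - {c}) \<times> ({..<N} - {c}). i < j}. g c i j) =
         (\<Sum>(i, j, l)\<in>triples N. g i j l + g j i l + g l i j)"
proof -
  let ?g = "\<lambda>(c, i, j). g c i j"
  define P where "P = (SIGMA c:{..<N}. {(i, j) \<in> ({..<N} - {c}) \<times> ({..<N} - {c}). i < j})"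
  have finI: "finite {(i, j) \<in> ({..<N} - {c}) \<times> ({..<N} - {c}). i < j}" for c
    by (rule finite_subset[of _ "{..<N} \<times> {..<N}"]) auto
  have finP: "finite P" using finI by (simp add: P_def)
  define P1 where "P1 = {(c, i, j) \<in> P. c < i}"
  define P2 where "P2 = {(c, i, j) \<in> P. i < c \<and> c < j}"
  define P3 where "P3 = {(c, i, j) \<in> P. j < c}"
  have fins: "finite P1" "finite P2" "finite P3"
    using finP by (auto simp: P1_def P2_def P3_def intro: finite_subset[of _ P])
  have "(\<Sum>c<N. \<Sum>(i, j)\<in>{(i, j) \<in> ({..<N} - {c}) \<times> ({..<N} - {c}). i < j}. g c i j) = sum ?g P"
    using finI by (simp add: P_def sum.Sigma)
  also have "P = (P1 \<union> P2) \<union> P3"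
    by (auto simp: P1_def P2_def P3_def P_def)
  also have "sum ?g \<dots> = sum ?g (P1 \<union> P2) + sum ?g P3"
    using fins by (intro sum.union_disjoint) (auto simp: P1_def P2_def P3_def P_def)
  also have "sum ?g (P1 \<union> P2) = sum ?g P1 + sum ?g P2"
    using fins by (intro sum.union_disjoint) (auto simp: P1_def P2_def)
  also have "sum ?g P1 = (\<Sum>(i, j, l)\<in>triples N. g i j l)"
    by (rule arg_cong[where f = "sum _"]) (auto simp: P1_def P_def triples_def)
  also have "sum ?g P2 = (\<Sum>(i, j, l)\<in>triples N. g j i l)"
    by (rule sum.reindex_bij_witness[where i = "\<lambda>(i, j, l). (j, i, l)" and j = "\<lambda>(i, j, l). (j, i, l)"])
      (auto simp: P2_def P_def triples_def)
  also have "sum ?g P3 = (\<Sum>(i, j, l)\<in>triples N. g l i j)"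
    by (rule sum.reindex_bij_witness[where i = "\<lambda>(i, j, l). (l, i, j)" and j = "\<lambda>(c, i, j). (i, j, c)"])
      (auto simp: P3_def P_def triples_def)
  finally show ?thesis by (simp add: sum.distrib case_prod_unfold)
qed

text \<open>The formula N (N - 1) (N - 2) / 6, arranged without division or subtraction. It follows
  by counting every triple once for each marked member.\<close>

lemma card_triples: "6 * card (triples N) + 3 * N * N = N * N * N + 2 * N"
proof -
  let ?V = "\<lambda>c. {..<N} - {c}"
  have "(\<Sum>c<N. card {(i, j) \<in> ?V c \<times> ?V c. i < j}) = 3 * card (triples N)"
    using sum_pointed_pairs[of "\<lambda>_ _ _. 1" N] by (simp add: case_prod_unfold)
  moreover define K where "K = N - 1"
  have "2 * card {(i, j) \<in> ?V c \<times> ?V c. i < j} + K = K * K" if "c < N" for c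
    using card_increasing_pairs[of "?V c"] that by (simp add: K_def)
  then have "(\<Sum>c<N. 2 * card {(i, j) \<in> ?V c \<times> ?V c. i < j} + K) = N * (K * K)"
    by simp
  ultimately have "6 * card (triples N) + N * K = N * (K * K)"
    by (simp add: sum.distrib sum_distrib_left[symmetric])
  then show ?thesis by (cases N) (simp_all add: K_def algebra_simps)
qed

text \<open>Count the triples with a marked member that beats exactly one of the other two. Marking
  \<open>c\<close> gives \<open>d c * d' c\<close> of them, whereas a cyclic triple is counted three
  times and a transitive one once.\<close>

lemma card_cyclic_triples:
  fixes T :: "nat \<Rightarrow> nat \<Rightarrow> bool" and N :: nat
  defines "d \<equiv> \<lambda>c. card {j \<in> {..<N} - {c}. T c j}"
  assumes T: "\<And>i j. i < N \<Longrightarrow> j < N \<Longrightarrow> i \<noteq> j \<Longrightarrow> T i j \<longleftrightarrow> \<not> T j i"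
  shows "12 * int (card {(i, j, l) \<in> triples N.
            (T i j \<noteq> T i l) = (T j i \<noteq> T j l) \<and> (T j i \<noteq> T j l) = (T l i \<noteq> T l j)})
         = int N * (int N - 1) * (2 * int N - 1) - 6 * (\<Sum>c<N. (int (d c))\<^sup>2)"
    and "2 * (\<Sum>c<N. int (d c)) = int N * (int N - 1)"
proof -
  have T1: "\<not> T j i" if "T i j" "j < i" "i < N" for i j using T[of i j] that by simp
  have T2: "T j i" if "\<not> T i j" "i < j" "j < N" for i j using T[of i j] that by simp
  let ?V = "\<lambda>c. {..<N} - {c}"
  let ?C = "{(i, j, l) \<in> triples N.
      (T i j \<noteq> T i l) = (T j i \<noteq> T j l) \<and> (T j i \<noteq> T j l) = (T l i \<noteq> T l j)}"
  define d' where "d' c = card {j \<in> ?V c. \<not> T c j}" for c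
  have dd: "int (d' c) = int N - 1 - int (d c)" if "c < N" for c
  proof -
    have "{j \<in> ?V c. T c j} \<union> {j \<in> ?V c. \<not> T c j} = ?V c" by auto
    then have "d c + d' c = card (?V c)"
      unfolding d_def d'_def by (subst card_Un_disjoint[symmetric]) auto
    then show ?thesis using that by simp
  qed
  have "(\<Sum>c<N. d c) = card (SIGMA c:{..<N}. {j \<in> ?V c. T c j})"
    by (simp add: d_def)
  also have "(SIGMA c:{..<N}. {j \<in> ?V c. T c j}) =
      {(i, j). i < N \<and> j < N \<and> i \<noteq> j \<and> T i j}" by auto
  also have "bij_betw (\<lambda>(i, j). if i < j then (i, j) else (j, i)) \<dots>
      {(i, j) \<in> {..<N} \<times> {..<N}. i < j}"
    by (intro bij_betw_byWitness[where f' = "\<lambda>(i, j). if T i j then (i, j) else (j, i)"])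
      (auto split: if_splits dest: T1 intro: T2)
  then have "card {(i, j). i < N \<and> j < N \<and> i \<noteq> j \<and> T i j} =
      card {(i, j) \<in> {..<N} \<times> {..<N}. i < j}"
    by (rule bij_betw_same_card)
  finally have "2 * (\<Sum>c<N. d c) + N = N * N"
    using card_increasing_pairs[of "{..<N}"] by simp
  from arg_cong[OF this, of int]
  show sum_d: "2 * (\<Sum>c<N. int (d c)) = int N * (int N - 1)"
    by (simp add: algebra_simps)
  have "(\<Sum>c<N. d c * d' c) =
      (\<Sum>c<N. \<Sum>(i, j)\<in>{(i, j) \<in> ?V c \<times> ?V c. i < j}. of_bool (T c i \<noteq> T c j))"
  proof (rule sum.cong[OF refl])
    fix c
    have fin: "finite {(i, j) \<in> ?V c \<times> ?V c. i < j}"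
      by (rule finite_subset[of _ "?V c \<times> ?V c"]) auto
    have "d c * d' c = card {(i, j) \<in> ?V c \<times> ?V c. i < j \<and> T c i \<noteq> T c j}"
      unfolding d_def d'_def by (rule card_mixed_pairs[symmetric]) simp
    also have "{(i, j) \<in> ?V c \<times> ?V c. i < j \<and> T c i \<noteq> T c j} =
        {(i, j) \<in> ?V c \<times> ?V c. i < j} \<inter> {(i, j). T c i \<noteq> T c j}" by auto
    also have "card \<dots> = (\<Sum>z\<in>{(i, j) \<in> ?V c \<times> ?V c. i < j}. of_bool (z \<in> {(i, j). T c i \<noteq> T c j}))"
      using fin by (subst sum_of_bool_eq) (auto intro: arg_cong[where f = card])
    finally show "d c * d' c =
        (\<Sum>(i, j)\<in>{(i, j) \<in> ?V c \<times> ?V c. i < j}. of_bool (T c i \<noteq> T c j))"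
      by (simp add: case_prod_unfold)
  qed
  also have "\<dots> = (\<Sum>(i, j, l)\<in>triples N. of_bool (T i j \<noteq> T i l) + of_bool (T j i \<noteq> T j l)
      + of_bool (T l i \<noteq> T l j))"
    by (rule sum_pointed_pairs)
  \<comment> \<open>In a transitive triple only the middle vertex has mixed results. No triple is
    without a mixed vertex, so three equal patterns mean that all three are mixed, that is, a cyclic
    triple.\<close>
  also have "\<dots> = (\<Sum>z\<in>triples N. 1 + 2 * of_bool (z \<in> ?C))"
  proof (intro sum.cong refl)
    fix z assume "z \<in> triples N"
    then obtain i j l where z: "z = (i, j, l)" "i < j" "j < l" "l < N" "z \<in> triples N"
      by (auto simp: triples_def)
    then have "T j i \<longleftrightarrow> \<not> T i j" "T l i \<longleftrightarrow> \<not> T i l" "T l j \<longleftrightarrow> \<not> T j l"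
      using T[of j i] T[of l i] T[of l j] by simp_all
    with z show "(case z of (i, j, l) \<Rightarrow> of_bool (T i j \<noteq> T i l) + of_bool (T j i \<noteq> T j l)
        + of_bool (T l i \<noteq> T l j)) = 1 + 2 * (of_bool (z \<in> ?C) :: nat)"
      by (cases "T i j"; cases "T i l"; cases "T j l") simp_all
  qed
  also have "\<dots> = card (triples N) + 2 * card ?C"
  proof -
    have "(\<Sum>z\<in>triples N. of_bool (z \<in> ?C)) = card (triples N \<inter> ?C)"
      by (subst sum_of_bool_eq) (simp_all only: finite_triples Collect_mem_eq of_nat_id)
    also have "triples N \<inter> ?C = ?C" by auto
    finally show ?thesis
      by (simp only: sum.distrib sum_distrib_left[symmetric] sum_constant mult_1_right of_nat_id)
  qed
  finally have "int (\<Sum>c<N. d c * d' c) = int (card (triples N)) + 2 * int (card ?C)"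
    by simp
  moreover have "int (\<Sum>c<N. d c * d' c) =
      (\<Sum>c<N. (int N - 1) * int (d c) - (int (d c))\<^sup>2)"
    by (simp add: dd algebra_simps power2_eq_square)
  moreover have "\<dots> = (int N - 1) * (\<Sum>c<N. int (d c)) - (\<Sum>c<N. (int (d c))\<^sup>2)"
    by (simp add: sum_subtractf sum_distrib_left)
  ultimately have "12 * int (card ?C) = 6 * (int N - 1) * (\<Sum>c<N. int (d c))
      - 6 * (\<Sum>c<N. (int (d c))\<^sup>2) - 6 * int (card (triples N))"
    by (simp only: algebra_simps)
  moreover have "6 * (int N - 1) * (\<Sum>c<N. int (d c)) = 3 * (int N - 1) * (int N * (int N - 1))"
    by (simp add: sum_d[symmetric])
  moreover have "6 * int (card (triples N)) = int N * int N * int N + 2 * int N - 3 * int N * int N"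
    using arg_cong[OF card_triples[of N], of int] by simp
  ultimately show "12 * int (card ?C)
      = int N * (int N - 1) * (2 * int N - 1) - 6 * (\<Sum>c<N. (int (d c))\<^sup>2)"
    by (simp add: algebra_simps)
qed

section \<open>Complete orthogonal arrays\<close>

text \<open>The array with its alphabet relabelled by \<open>{..<n}\<close>; columns are
  \<open>0\<close> to \<open>n\<close>. Orthogonality is phrased as a bijection so that inversions
  can be reindexed along it.\<close>

locale complete_array =
  fixes n :: nat and B :: "nat \<Rightarrow> nat \<Rightarrow> nat"
  assumes n_ge_2: "n \<ge> 2"
    and bij_rows: "i \<le> n \<Longrightarrow> j \<le> n \<Longrightarrow> i \<noteq> j \<Longrightarrow>
      bij_betw (\<lambda>r. (B r i, B r j)) {..<n\<^sup>2} ({..<n} \<times> {..<n})"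
begin

abbreviation rows :: "nat set" where "rows \<equiv> {..<n\<^sup>2}"

lemma other_column:
  obtains j where "j \<le> n" "i \<noteq> j"
proof
  show "(if i = 0 then 1 else 0) \<le> n" "i \<noteq> (if i = 0 then 1 else 0)" using n_ge_2 by auto
qed

lemma entry_less:
  assumes "r \<in> rows" "i \<le> n"
  shows "B r i < n"
proof -
  obtain j where j: "j \<le> n" "i \<noteq> j" by (rule other_column)
  then have "(B r i, B r j) \<in> {..<n} \<times> {..<n}"
    using bij_betwE[OF bij_rows[OF assms(2) j]] assms(1) by blast
  then show ?thesis by simp
qed

lemma rows_eqI:
  assumes "p \<in> rows" "q \<in> rows" "i \<le> n" "j \<le> n" "i \<noteq> j" "B p i = B q i" "B p j = B q j"
  shows "p = q"
  using bij_rows[OF assms(3-5)] assms by (auto simp: bij_betw_def inj_on_def)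

lemma bij_block:
  assumes "i \<le> n" "j \<le> n" "i \<noteq> j" "x < n"
  shows "bij_betw (\<lambda>r. B r j) {r \<in> rows. B r i = x} {..<n}"
proof -
  have "inj_on (\<lambda>r. B r j) {r \<in> rows. B r i = x}"
    using rows_eqI assms by (auto intro!: inj_onI)
  moreover have "\<exists>r. r \<in> rows \<and> B r i = x \<and> B r j = y" if "y < n" for y
  proof -
    have "(x, y) \<in> (\<lambda>r. (B r i, B r j)) ` rows"
      using bij_betw_imp_surj_on[OF bij_rows[OF assms(1-3)]] assms that by auto
    then show ?thesis by auto
  qed
  ultimately show ?thesis using entry_less assms by (fastforce simp: bij_betw_def)
qed

text \<open>Each of the \<open>n + 1\<close> columns makes \<open>n - 1\<close> other rows agree
  with \<open>p\<close>, and no row does so in two columns. These are (n + 1) (n - 1) = n^2 - 1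
  rows, hence all the others.\<close>

lemma agreeing_column:
  assumes p: "p \<in> rows" and q: "q \<in> rows" and "p \<noteq> q"
  obtains i where "i \<le> n" "B p i = B q i"
proof -
  define C where "C i = {r \<in> rows. B r i = B p i} - {p}" for i
  have card_C: "card (C i) = n - 1" if "i \<le> n" for i
  proof -
    obtain j where "j \<le> n" "i \<noteq> j" by (rule other_column)
    then have "card {r \<in> rows. B r i = B p i} = n"
      using bij_betw_same_card[OF bij_block[of i j "B p i"]] entry_less[OF p that] that by simp
    then show ?thesis using p by (simp add: C_def)
  qed
  have "card (\<Union>i\<in>{..n}. C i) = (\<Sum>i\<in>{..n}. card (C i))"
  proof (rule card_UN_disjoint)
    show "\<forall>i\<in>{..n}. \<forall>j\<in>{..n}. i \<noteq> j \<longrightarrow> C i \<inter> C j = {}"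
      using rows_eqI p by (fastforce simp: C_def)
  qed (auto simp: C_def)
  also have "\<dots> = (n + 1) * (n - 1)" using card_C by simp
  also have "\<dots> = n\<^sup>2 - 1" by (cases n) (simp_all add: power2_eq_square)
  also have "\<dots> = card (rows - {p})" using p by simp
  finally have "(\<Union>i\<in>{..n}. C i) = rows - {p}"
    by (intro card_subset_eq) (auto simp: C_def)
  then have "q \<in> (\<Union>i\<in>{..n}. C i)" using q \<open>p \<noteq> q\<close> by simp
  then show ?thesis using that by (auto simp: C_def)
qed

text \<open>Two columns together run once through all pairs of symbols, so an inversion is an
  independent choice of an increasing pair for one column and a decreasing pair for the
  other.\<close>

lemma card_inversions_columns:
  assumes "i \<le> n" "j \<le> n" "i \<noteq> j"
  shows "card (inversions rows (\<lambda>r. B r i) (\<lambda>r. B r j)) = (n choose 2)\<^sup>2"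
proof -
  have "bij_betw (\<lambda>r. (B r i, B r j)) rows ({..<n} \<times> {..<n})"
    using assms by (rule bij_rows)
  from card_inversions_reindex[OF this, of fst snd]
  have "card (inversions rows (\<lambda>r. B r i) (\<lambda>r. B r j)) =
      card (inversions ({..<n} \<times> {..<n}) fst snd)"
    by (simp add: comp_def)
  also have "bij_betw (\<lambda>((x, y), (x', y')). ((x, x'), (y', y)))
      (inversions ({..<n} \<times> {..<n}) fst snd)
      ({(a, b) \<in> {..<n} \<times> {..<n}. a < b} \<times> {(a, b) \<in> {..<n} \<times> {..<n}. a < b})"
    by (rule bij_betw_byWitness[where f' = "\<lambda>((x, x'), (y', y)). ((x, y), (x', y'))"])
      (auto simp: inversions_def)
  then have "card (inversions ({..<n} \<times> {..<n}) fst snd) =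
      card {(a, b) \<in> {..<n} \<times> {..<n}. a < b} * card {(a, b) \<in> {..<n} \<times> {..<n}. a < b}"
    by (simp add: bij_betw_same_card card_cartesian_product)
  also have "card {(a, b) \<in> {..<n} \<times> {..<n}. a < b} = n choose 2"
    using card_increasing_pairs[of "{..<n}"] n_ge_2
    by (simp add: choose_two diff_mult_distrib2)
  finally show ?thesis by (simp add: power2_eq_square)
qed

section \<open>Lexicographic orders of the rows and the tournament of columns\<close>

definition key :: "nat \<Rightarrow> nat \<Rightarrow> nat \<Rightarrow> nat" where
  "key i j r = n * B r i + B r j"

text \<open>The entries are less than \<open>n\<close>, hence are the base \<open>n\<close> digits
  of the key.\<close>

lemma key_less_iff:
  assumes "p \<in> rows" "q \<in> rows" "i \<le> n" "j \<le> n"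
  shows "key i j p < key i j q \<longleftrightarrow> B p i < B q i \<or> B p i = B q i \<and> B p j < B q j"
proof -
  have *: "n * a + b < n * a' + b'" if "a < a'" "b < n" for a b a' b'
  proof -
    have "n * Suc a \<le> n * a'" using that by (intro mult_le_mono2) simp
    with that show ?thesis by simp
  qed
  show ?thesis
    using *[of "B p i" "B q i" "B p j" "B q j"] *[of "B q i" "B p i" "B q j" "B p j"]
      entry_less[of p j] entry_less[of q j] assms
    by (cases "B p i" "B q i" rule: linorder_cases) (auto simp: key_def)
qed

lemma inj_on_key:
  assumes "i \<le> n" "j \<le> n" "i \<noteq> j"
  shows "inj_on (key i j) rows"
proof (rule inj_onI)
  fix p q assume pq: "p \<in> rows" "q \<in> rows" and "key i j p = key i j q"
  then have "\<not> key i j p < key i j q" "\<not> key i j q < key i j p" by auto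
  then have "B p i = B q i" "B p j = B q j"
    using key_less_iff pq assms by (metis linorder_neqE_nat)+
  then show "p = q" using rows_eqI pq assms by blast
qed

text \<open>The row numbering \<open>id\<close> is only a reference order: it cancels when two keys
  are compared by \<open>even_card_inversions_trans\<close>.\<close>

definition beats :: "nat \<Rightarrow> nat \<Rightarrow> bool" where
  "beats i j \<longleftrightarrow> odd (card (inversions rows id (key i j)))"

text \<open>The keys \<open>key c i\<close> and \<open>key c j\<close> order rows from different
  blocks of column \<open>c\<close> identically, so they disagree only inside a block, where they
  compare columns \<open>i\<close> and \<open>j\<close>.\<close>

lemma odd_block_inversions_iff:
  assumes "c \<le> n" "i \<le> n" "j \<le> n" "c \<noteq> i" "c \<noteq> j"
  shows "odd (card (block_inversions rows (\<lambda>r. B r c) (\<lambda>r. B r i) (\<lambda>r. B r j)))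
    \<longleftrightarrow> beats c i \<noteq> beats c j"
proof -
  have "block_inversions rows (\<lambda>r. B r c) (\<lambda>r. B r i) (\<lambda>r. B r j) =
      inversions rows (key c i) (key c j)"
    unfolding block_inversions_def inversions_def using key_less_iff assms by fastforce
  then show ?thesis
    using even_card_inversions_trans[of rows id "key c i" "key c j"] inj_on_key assms
    by (auto simp: beats_def)
qed

text \<open>Exchanging the two columns in the key reverses exactly the pairs of rows that the
  columns order oppositely; a tie in one column leaves the decision to the other in both keys. The
  number of reversed pairs is the square of an odd number.\<close>

lemma beats_asym:
  assumes "i \<le> n" "j \<le> n" "i \<noteq> j" and odd: "odd (n choose 2)"
  shows "beats i j \<longleftrightarrow> \<not> beats j i"
proof -
  have "inversions rows (key i j) (key j i) = inversions rows (\<lambda>r. B r i) (\<lambda>r. B r j)"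
    unfolding inversions_def using key_less_iff assms by fastforce
  then have "odd (card (inversions rows (key i j) (key j i)))"
    using card_inversions_columns assms by simp
  then show ?thesis
    using even_card_inversions_trans[of rows id "key i j" "key j i"] inj_on_key assms
    by (auto simp: beats_def)
qed

text \<open>Two rows forming an inversion of \<open>c\<close> and \<open>c'\<close> differ in both
  columns, so the one column in which they agree is a third one; the inversions are sorted by
  it.\<close>

lemma sum_block_inversions:
  assumes "c \<le> n" "c' \<le> n" "c \<noteq> c'"
  shows "(\<Sum>i\<in>{..n} - {c, c'}.
      card (block_inversions rows (\<lambda>r. B r i) (\<lambda>r. B r c) (\<lambda>r. B r c'))) = (n choose 2)\<^sup>2"
proof -
  have "inversions rows (\<lambda>r. B r c) (\<lambda>r. B r c') =
      (\<Union>i\<in>{..n} - {c, c'}. block_inversions rows (\<lambda>r. B r i) (\<lambda>r. B r c) (\<lambda>r. B r c'))"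
    (is "?I = ?U")
  proof (intro subset_antisym subsetI)
    fix z assume "z \<in> ?I"
    then obtain p q where z: "z = (p, q)" and pq: "p \<in> rows" "q \<in> rows"
      "B p c < B q c" "B q c' < B p c'" by (auto simp: inversions_def)
    then have "p \<noteq> q" by auto
    with pq obtain i where i: "i \<le> n" "B p i = B q i" using agreeing_column by metis
    then have "i \<noteq> c" "i \<noteq> c'" using pq by auto
    then show "z \<in> ?U" using z pq i by (auto simp: block_inversions_def)
  qed (auto simp: inversions_def block_inversions_def)
  moreover have "card ?U = (\<Sum>i\<in>{..n} - {c, c'}.
      card (block_inversions rows (\<lambda>r. B r i) (\<lambda>r. B r c) (\<lambda>r. B r c')))"
  proof (rule card_UN_disjoint)
    show "\<forall>i\<in>{..n} - {c, c'}. \<forall>j\<in>{..n} - {c, c'}. i \<noteq> j \<longrightarrow>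
        block_inversions rows (\<lambda>r. B r i) (\<lambda>r. B r c) (\<lambda>r. B r c') \<inter>
        block_inversions rows (\<lambda>r. B r j) (\<lambda>r. B r c) (\<lambda>r. B r c') = {}"
      using rows_eqI by (fastforce simp: block_inversions_def)
  qed auto
  ultimately show ?thesis using card_inversions_columns[OF assms] by simp
qed

section \<open>Parity of the scores and the sum of their squares\<close>

definition score :: "nat \<Rightarrow> nat" where
  "score c = card {j \<in> {..<n + 1} - {c}. beats c j}"

text \<open>Isolating the game between \<open>a\<close> and \<open>b\<close> lets their scores be
  compared over the same remaining opponents.\<close>

lemma score_split:
  assumes "a \<le> n" "b \<le> n" "a \<noteq> b"
  shows "score a = card {i \<in> {..n} - {a, b}. beats a i} + of_bool (beats a b)"
proof -
  let ?J = "{i \<in> {..n} - {a, b}. beats a i}"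
  have "{j \<in> {..<n + 1} - {a}. beats a j} = (if beats a b then insert b ?J else ?J)"
    using assms by auto
  moreover have "card (insert b ?J) = card ?J + 1" by (subst card_insert_disjoint) auto
  ultimately show ?thesis
    unfolding score_def
    by (cases "beats a b") (simp_all only: if_True if_False of_bool_eq add_0_right)
qed

text \<open>By \<open>sum_block_inversions\<close>, an odd number of other columns \<open>i\<close>
  give \<open>c\<close> and \<open>c'\<close> different results, so their scores over the common
  opponents differ in parity. The game between \<open>c\<close> and \<open>c'\<close>, won by
  exactly one of them, evens this out.\<close>

lemma even_score_iff:
  assumes c: "c \<le> n" "c' \<le> n" and odd: "odd (n choose 2)"
  shows "even (score c) \<longleftrightarrow> even (score c')"
proof (cases "c = c'")
  case False
  define I where "I = {..n} - {c, c'}"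
  have finI: "finite I" by (simp add: I_def)
  define s where "s i = card (block_inversions rows (\<lambda>r. B r i) (\<lambda>r. B r c) (\<lambda>r. B r c'))" for i
  have "sum s I = (n choose 2)\<^sup>2"
    unfolding s_def I_def by (rule sum_block_inversions[OF c False])
  then have "odd (sum s I)" using odd by simp
  then have "odd (card {i \<in> I. odd (s i)})" using even_sum_iff[OF finI] by blast
  also have "{i \<in> I. odd (s i)} = {i \<in> I. beats c i \<noteq> beats c' i}"
  proof (intro Collect_cong conj_cong refl)
    fix i assume "i \<in> I"
    then have i: "i \<le> n" "c \<noteq> i" "c' \<noteq> i" "i \<noteq> c" "i \<noteq> c'" by (auto simp: I_def)
    have "odd (s i) \<longleftrightarrow> beats i c \<noteq> beats i c'"
      unfolding s_def by (rule odd_block_inversions_iff[OF i(1) c i(4,5)])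
    moreover have "beats c i \<longleftrightarrow> \<not> beats i c" "beats c' i \<longleftrightarrow> \<not> beats i c'"
      using beats_asym[OF _ i(1) _ odd] c i by blast+
    ultimately show "odd (s i) \<longleftrightarrow> beats c i \<noteq> beats c' i" by blast
  qed
  finally have "odd (card {i \<in> I. beats c i}) \<noteq> odd (card {i \<in> I. beats c' i})"
    using even_card_symdiff[OF finI] by blast
  moreover have "score c = card {i \<in> I. beats c i} + of_bool (beats c c')"
    "score c' = card {i \<in> I. beats c' i} + of_bool (beats c' c)"
    using score_split[OF c False] score_split[OF c(2,1) not_sym[OF False]]
    by (simp_all only: I_def insert_commute)
  ultimately show ?thesis using beats_asym[OF c False odd] by (cases "beats c c'") simp_all
qed simp

text \<open>Each \<open>\<noteq>\<close> is the parity obtained with one column fixed, so the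
  condition equates the three parities of a Latin square. It has the form counted by
  \<open>card_cyclic_triples\<close>.\<close>

definition aligned_triples :: "(nat \<times> nat \<times> nat) set" where
  "aligned_triples = {(i, j, l) \<in> triples (n + 1).
     (beats i j \<noteq> beats i l) = (beats j i \<noteq> beats j l) \<and>
     (beats j i \<noteq> beats j l) = (beats l i \<noteq> beats l j)}"

text \<open>All scores have the same parity. If they are even, then \<open>n\<close> is odd, and replacing every score
  \<open>d\<close> by \<open>n - d\<close> makes them odd without changing the sum of their squares.\<close>

lemma sum_score_squares:
  assumes n: "[n = 2] (mod 4) \<or> [n = 3] (mod 4)" and odd: "odd (n choose 2)"
  shows "[(\<Sum>c<n + 1. (int (score c))\<^sup>2) = int (n + 1)] (mod 8)"
proof -
  have sum: "2 * (\<Sum>c<n + 1. int (score c)) = int (n + 1) * int n"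
    using card_cyclic_triples(2)[of "n + 1" beats, OF beats_asym[OF _ _ _ odd]]
    by (simp add: score_def)
  have sq: "[x\<^sup>2 = 1] (mod 8)" if "odd x" for x :: int
  proof -
    obtain y where x: "x = 2 * y + 1" using \<open>odd x\<close> by (rule oddE)
    have "even (y * (y + 1))" by simp
    then obtain z where "y * (y + 1) = 2 * z" by (rule evenE)
    then have "x\<^sup>2 - 1 = 8 * z" by (simp add: x power2_eq_square algebra_simps)
    then show ?thesis by (simp add: cong_iff_dvd_diff)
  qed
  have sums: "[(\<Sum>c<n + 1. (f c)\<^sup>2) = int (n + 1)] (mod 8)"
    if "\<And>c. c \<le> n \<Longrightarrow> odd (f c)" for f :: "nat \<Rightarrow> int"
  proof -
    have "[(\<Sum>c<n + 1. (f c)\<^sup>2) = (\<Sum>c<n + 1. 1)] (mod 8)"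
      by (rule cong_sum) (simp add: sq that)
    then show ?thesis by simp
  qed
  show ?thesis
  proof (cases "odd (score 0)")
    case True
    then have "odd (score c)" if "c \<le> n" for c
      using even_score_iff[OF that _ odd, of 0] by simp
    then show ?thesis by (intro sums) simp
  next
    case False
    then have ev: "even (score c)" if "c \<le> n" for c
      using even_score_iff[OF that _ odd, of 0] by simp
    then have "even (\<Sum>c<n + 1. int (score c))" by (intro dvd_sum) simp
    then obtain t where "(\<Sum>c<n + 1. int (score c)) = 2 * t" by (rule evenE)
    with sum have t: "4 * t = int (n + 1) * int n" by simp
    \<comment> \<open>Even scores make n (n + 1), twice their sum, divisible by 4; for n = 4 k + 2
      it is 2 modulo 4.\<close>
    have "odd n"
    proof (rule ccontr)
      assume "\<not> odd n"
      with n have "n mod 4 = 2" unfolding cong_def by presburger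
      then obtain k where "n = 4 * k + 2" by (metis mult_div_mod_eq)
      with t have "4 * t = int (4 * (4 * k * k + 5 * k + 1) + 2)" by (simp add: algebra_simps)
      then show False by presburger
    qed
    then have "[(\<Sum>c<n + 1. (int n - int (score c))\<^sup>2) = int (n + 1)] (mod 8)"
      using ev by (intro sums) simp
    \<comment> \<open>Twice the sum of the scores is n (n + 1), so the first two terms of the
      expansion cancel.\<close>
    also have "(\<Sum>c<n + 1. (int n - int (score c))\<^sup>2) =
        int (n + 1) * (int n)\<^sup>2 - int n * (2 * (\<Sum>c<n + 1. int (score c)))
        + (\<Sum>c<n + 1. (int (score c))\<^sup>2)"
      by (simp only: power2_diff sum.distrib sum_subtractf sum_distrib_left sum_constant card_lessThan
          mult_ac of_nat_mult)
    also have "\<dots> = (\<Sum>c<n + 1. (int (score c))\<^sup>2)"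
      unfolding sum by (simp add: power2_eq_square algebra_simps)
    finally show ?thesis .
  qed
qed

lemma card_aligned_triples:
  assumes n: "[n = 2] (mod 4) \<or> [n = 3] (mod 4)" and odd: "odd (n choose 2)"
  shows "[int (card aligned_triples) = \<lceil>real n / 4\<rceil>] (mod 4)"
proof -
  have "12 * int (card aligned_triples) =
      int (n + 1) * int n * (2 * int n + 1) - 6 * (\<Sum>c<n + 1. (int (score c))\<^sup>2)"
    using card_cyclic_triples(1)[of "n + 1" beats, OF beats_asym[OF _ _ _ odd]]
    by (simp add: score_def aligned_triples_def)
  moreover obtain t where "(\<Sum>c<n + 1. (int (score c))\<^sup>2) = int (n + 1) + 8 * t"
    using sum_score_squares[OF assms] by (metis cong_iff_lin cong_sym)
  \<comment> \<open>The unknown multiple of 8 enters with factor 6, giving 48 \<open>t\<close>,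
    which is 12 times a multiple of 4: knowing the squares modulo 8 is just enough.\<close>
  ultimately have E: "12 * int (card aligned_triples) =
      int (n + 1) * (int n * (2 * int n + 1) - 6) - 48 * t"
    by (simp add: algebra_simps)
  define k where "k = n div 4"
  have k: "n = 4 * k + 2 \<or> n = 4 * k + 3"
    using n unfolding cong_def k_def by presburger
  then have ceiling: "\<lceil>real n / 4\<rceil> = int k + 1" by (auto simp: ceiling_eq_iff)
  \<comment> \<open>Dividing \<open>E\<close> by 4 makes 3 times the count, up to 12
    \<open>t\<close>, equal to k + 1 times a number congruent to 3 modulo 4. The factor 3 is
    invertible modulo 4.\<close>
  have "\<exists>m. 3 * (int (card aligned_triples) - (int k + 1)) = 4 * m"
    using k
  proof
    assume "n = 4 * k + 2"
    with E have "3 * (int (card aligned_triples) - (int k + 1)) =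
        4 * ((int k + 1) * (8 * int k * int k + 7 * int k) - 3 * t)"
      by (simp add: algebra_simps)
    then show ?thesis ..
  next
    assume "n = 4 * k + 3"
    with E have "3 * (int (card aligned_triples) - (int k + 1)) =
        4 * ((int k + 1) * (8 * int k * int k + 13 * int k + 3) - 3 * t)"
      by (simp add: algebra_simps)
    then show ?thesis ..
  qed
  then have "4 dvd int (card aligned_triples) - (int k + 1)" by presburger
  then show ?thesis by (simp add: cong_iff_dvd_diff ceiling)
qed

end

section \<open>Parities of the ensemble\<close>

context
  fixes n :: nat and \<Lambda> :: "'a set" and A :: "'a mat" and e :: "'a \<Rightarrow> nat"
  assumes A: "orthogonal_array (n + 1) n \<Lambda> A"
    and e: "bij_betw e \<Lambda> {..<n}"
begin

lemma entry_mem: "r < n\<^sup>2 \<Longrightarrow> i \<le> n \<Longrightarrow> A $$ (r, i) \<in> \<Lambda>"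
  using A by (simp add: orthogonal_array_def)

lemma unique_row:
  assumes "i \<le> n" "j \<le> n" "i \<noteq> j" "x \<in> \<Lambda>" "y \<in> \<Lambda>"
  shows "\<exists>!r. r < n\<^sup>2 \<and> A $$ (r, i) = x \<and> A $$ (r, j) = y"
  using A assms by (simp add: orthogonal_array_def)

lemma bij_betw_rows:
  assumes "i \<le> n" "j \<le> n" "i \<noteq> j"
  shows "bij_betw (\<lambda>r. (A $$ (r, i), A $$ (r, j))) {..<n\<^sup>2} (\<Lambda> \<times> \<Lambda>)"
proof (rule bij_betw_imageI)
  show "inj_on (\<lambda>r. (A $$ (r, i), A $$ (r, j))) {..<n\<^sup>2}"
  proof (rule inj_onI)
    fix p q assume "p \<in> {..<n\<^sup>2}" "q \<in> {..<n\<^sup>2}"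
      and "(A $$ (p, i), A $$ (p, j)) = (A $$ (q, i), A $$ (q, j))"
    then show "p = q"
      using unique_row[OF assms, of "A $$ (q, i)" "A $$ (q, j)"] entry_mem assms by auto
  qed
  show "(\<lambda>r. (A $$ (r, i), A $$ (r, j))) ` {..<n\<^sup>2} = \<Lambda> \<times> \<Lambda>"
  proof (intro subset_antisym subsetI)
    fix z assume "z \<in> \<Lambda> \<times> \<Lambda>"
    then obtain x y where z: "z = (x, y)" and xy: "x \<in> \<Lambda>" "y \<in> \<Lambda>" by auto
    then obtain r where "r < n\<^sup>2" "A $$ (r, i) = x" "A $$ (r, j) = y"
      using unique_row[OF assms xy] by auto
    with z show "z \<in> (\<lambda>r. (A $$ (r, i), A $$ (r, j))) ` {..<n\<^sup>2}" by auto
  qed (use entry_mem assms in auto)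
qed

lemma bij_betw_row_block:
  assumes "i \<le> n" "j \<le> n" "i \<noteq> j" "x \<in> \<Lambda>"
  shows "bij_betw (\<lambda>r. A $$ (r, j)) {r \<in> {..<n\<^sup>2}. A $$ (r, i) = x} \<Lambda>"
proof (rule bij_betw_imageI)
  show "inj_on (\<lambda>r. A $$ (r, j)) {r \<in> {..<n\<^sup>2}. A $$ (r, i) = x}"
  proof (rule inj_onI)
    fix p q assume "p \<in> {r \<in> {..<n\<^sup>2}. A $$ (r, i) = x}" "q \<in> {r \<in> {..<n\<^sup>2}. A $$ (r, i) = x}"
      and "A $$ (p, j) = A $$ (q, j)"
    then show "p = q"
      using unique_row[OF assms, of "A $$ (q, j)"] entry_mem[of q j] assms(2) by auto
  qed
  show "(\<lambda>r. A $$ (r, j)) ` {r \<in> {..<n\<^sup>2}. A $$ (r, i) = x} = \<Lambda>"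
  proof (intro subset_antisym subsetI)
    fix y assume y: "y \<in> \<Lambda>"
    then obtain r where "r < n\<^sup>2" "A $$ (r, i) = x" "A $$ (r, j) = y"
      using unique_row[OF assms y] by auto
    then show "y \<in> (\<lambda>r. A $$ (r, j)) ` {r \<in> {..<n\<^sup>2}. A $$ (r, i) = x}" by auto
  qed (use entry_mem assms in auto)
qed

lemma complete_array_labels:
  assumes "n \<ge> 2"
  shows "complete_array n (\<lambda>r i. e (A $$ (r, i)))"
proof
  fix i j assume "i \<le> n" "j \<le> n" "i \<noteq> j"
  then have "bij_betw (map_prod e e \<circ> (\<lambda>r. (A $$ (r, i), A $$ (r, j)))) {..<n\<^sup>2} ({..<n} \<times> {..<n})"
    by (intro bij_betw_trans[OF bij_betw_rows] bij_betw_map_prod e)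
  then show "bij_betw (\<lambda>r. (e (A $$ (r, i)), e (A $$ (r, j)))) {..<n\<^sup>2} ({..<n} \<times> {..<n})"
    by (simp add: comp_def)
qed (rule assms)

abbreviation block_parity :: "nat \<Rightarrow> nat \<Rightarrow> nat \<Rightarrow> nat" where
  "block_parity c u v \<equiv> card (block_inversions {..<n\<^sup>2} (\<lambda>r. e (A $$ (r, c)))
     (\<lambda>r. e (A $$ (r, u))) (\<lambda>r. e (A $$ (r, v))))"

text \<open>One statement for all three parities: in the rows with entry \<open>x\<close> in column
  \<open>c\<close>, \<open>f x\<close> carries the entry of column \<open>u\<close> to that of
  column \<open>v\<close>. Pulled back along column \<open>u\<close>, its inversions become those
  between the two columns.\<close>

lemma sum_parity_on:
  assumes cols: "c \<le> n" "u \<le> n" "v \<le> n" "c \<noteq> u" "c \<noteq> v"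
    and f: "\<And>r. r < n\<^sup>2 \<Longrightarrow> f (A $$ (r, c)) (A $$ (r, u)) = A $$ (r, v)"
  shows "(\<Sum>x\<in>\<Lambda>. parity_on \<Lambda> (f x)) = of_nat (block_parity c u v)"
proof -
  have fin: "finite \<Lambda>" using A by (simp add: orthogonal_array_def)
  have inj: "inj_on e \<Lambda>" using e by (rule bij_betw_imp_inj_on)
  let ?X = "\<lambda>x. {r \<in> {..<n\<^sup>2}. A $$ (r, c) = x}"
  have "parity_on \<Lambda> (f x) =
      of_nat (card (inversions (?X x) (\<lambda>r. e (A $$ (r, u))) (\<lambda>r. e (A $$ (r, v)))))"
    if x: "x \<in> \<Lambda>" for x
  proof -
    have u: "bij_betw (\<lambda>r. A $$ (r, u)) (?X x) \<Lambda>" and v: "bij_betw (\<lambda>r. A $$ (r, v)) (?X x) \<Lambda>"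
      using bij_betw_row_block cols x by simp_all
    have fv: "f x (A $$ (r, u)) = A $$ (r, v)" if "r \<in> ?X x" for r
      using f[of r] that by auto
    \<comment> \<open>Composing \<open>f x\<close> with the bijection given by column
      \<open>u\<close> yields column \<open>v\<close>, again a bijection, which forces
      \<open>f x\<close> to be one.\<close>
    have "bij_betw (f x \<circ> (\<lambda>r. A $$ (r, u))) (?X x) \<Lambda>"
      by (rule bij_betw_cong[THEN iffD1, OF _ v]) (simp only: fv o_apply)
    then have "bij_betw (f x) \<Lambda> \<Lambda>" using bij_betw_comp_iff[OF u] by blast
    then have "parity_on \<Lambda> (f x) = of_nat (card (inversions \<Lambda> e (e \<circ> f x)))"
      by (rule parity_on_eq_inversions[OF fin inj])
    also have "card (inversions \<Lambda> e (e \<circ> f x)) =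
        card (inversions (?X x) (e \<circ> (\<lambda>r. A $$ (r, u))) (e \<circ> f x \<circ> (\<lambda>r. A $$ (r, u))))"
      by (rule card_inversions_reindex[OF u])
    also have "inversions (?X x) (e \<circ> (\<lambda>r. A $$ (r, u))) (e \<circ> f x \<circ> (\<lambda>r. A $$ (r, u))) =
        inversions (?X x) (\<lambda>r. e (A $$ (r, u))) (\<lambda>r. e (A $$ (r, v)))"
      by (rule inversions_cong) (simp_all only: o_apply fv)
    finally show ?thesis .
  qed
  then have "(\<Sum>x\<in>\<Lambda>. parity_on \<Lambda> (f x)) =
      of_nat (\<Sum>x\<in>\<Lambda>. card (inversions (?X x) (\<lambda>r. e (A $$ (r, u))) (\<lambda>r. e (A $$ (r, v)))))"
    by simp
  also have "(\<Sum>x\<in>\<Lambda>. card (inversions (?X x) (\<lambda>r. e (A $$ (r, u))) (\<lambda>r. e (A $$ (r, v))))) =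
      card (block_inversions {..<n\<^sup>2} (\<lambda>r. A $$ (r, c)) (\<lambda>r. e (A $$ (r, u))) (\<lambda>r. e (A $$ (r, v))))"
    by (rule card_block_inversions[symmetric]) (use fin entry_mem cols in auto)
  also have "block_inversions {..<n\<^sup>2} (\<lambda>r. A $$ (r, c)) (\<lambda>r. e (A $$ (r, u))) (\<lambda>r. e (A $$ (r, v))) =
      block_inversions {..<n\<^sup>2} (\<lambda>r. e (A $$ (r, c))) (\<lambda>r. e (A $$ (r, u))) (\<lambda>r. e (A $$ (r, v)))"
    using inj_on_eq_iff[OF inj] entry_mem cols by (auto simp: block_inversions_def)
  finally show ?thesis .
qed

text \<open>Row, column and symbol parity fix column \<open>i\<close>, \<open>j\<close> and
  \<open>l\<close> respectively and compare the other two.\<close>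

lemma equiparity_iff:
  assumes ijl: "i < j" "j < l" "l \<le> n"
  shows "equiparity \<Lambda> (ensemble_square A i j l) \<longleftrightarrow>
    odd (block_parity i j l) = odd (block_parity j i l) \<and>
    odd (block_parity j i l) = odd (block_parity l i j)"
proof -
  let ?L = "ensemble_square A i j l"
  have L: "?L (A $$ (r, i)) (A $$ (r, j)) = A $$ (r, l)" if "r < n\<^sup>2" for r
    using ensemble_square_row[OF A] ijl that by simp
  have "latin_square \<Lambda> ?L"
    using latin_square_ensemble_square[OF A] ijl by simp
  then have inj: "inj_on (?L x) \<Lambda>" if "x \<in> \<Lambda>" for x
    using that by (auto simp: latin_square_def bij_betw_def)
  \<comment> \<open>Rows of the Latin square are injective, so the description picks out the entry
    of column \<open>j\<close>, as \<open>sum_parity_on\<close> requires with \<open>l\<close>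
    fixed.\<close>
  have symbol: "(THE y. y \<in> \<Lambda> \<and> ?L (A $$ (r, i)) y = A $$ (r, l)) = A $$ (r, j)"
    if r: "r < n\<^sup>2" for r
  proof (rule the_equality)
    show "A $$ (r, j) \<in> \<Lambda> \<and> ?L (A $$ (r, i)) (A $$ (r, j)) = A $$ (r, l)"
      using L[OF r] entry_mem[OF r] ijl by simp
    fix y assume y: "y \<in> \<Lambda> \<and> ?L (A $$ (r, i)) y = A $$ (r, l)"
    have "A $$ (r, i) \<in> \<Lambda>" "A $$ (r, j) \<in> \<Lambda>" using entry_mem[OF r] ijl by simp_all
    then show "y = A $$ (r, j)"
      using y L[OF r] by (intro inj_onD[OF inj[of "A $$ (r, i)"], of y]) simp_all
  qed
  have "row_parity \<Lambda> ?L = of_nat (block_parity i j l)"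
    unfolding row_parity_def by (rule sum_parity_on) (use ijl L in auto)
  moreover have "column_parity \<Lambda> ?L = of_nat (block_parity j i l)"
    unfolding column_parity_def by (rule sum_parity_on) (use ijl L in auto)
  moreover have "symbol_parity \<Lambda> ?L = of_nat (block_parity l i j)"
    unfolding symbol_parity_def by (rule sum_parity_on) (use ijl symbol in auto)
  ultimately show ?thesis by (simp add: equiparity_def of_nat_bit)
qed

end

section \<open>The residue condition on \<open>n\<close> and the final count\<close>

lemma odd_choose_two:
  assumes "[n = 2] (mod 4) \<or> [n = 3] (mod 4)"
  shows "odd (n choose 2)"
proof -
  define k where "k = n div 4"
  have "n = 4 * k + 2 \<or> n = 4 * k + 3"
    using assms unfolding cong_def k_def by presburger
  then show ?thesis
  proof
    assume n: "n = 4 * k + 2"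
    have "n * (n - 1) = 2 * (2 * (4 * k * k + 3 * k) + 1)" by (simp add: n algebra_simps)
    then show ?thesis by (simp add: choose_two)
  next
    assume n: "n = 4 * k + 3"
    have "n * (n - 1) = 2 * (2 * (4 * k * k + 5 * k + 1) + 1)" by (simp add: n algebra_simps)
    then show ?thesis by (simp add: choose_two)
  qed
qed

theorem theorem6p8:
  fixes n :: nat and \<Lambda> :: "'a set" and A :: "'a mat"
  assumes "n \<ge> 2"
    and "[n = 2] (mod 4) \<or> [n = 3] (mod 4)"
    and "orthogonal_array (n + 1) n \<Lambda> A"
  shows "[int (card {(i, j, l). i < j \<and> j < l \<and> l < n + 1 \<and>
                       equiparity \<Lambda> (ensemble_square A i j l)})
          = \<lceil>real n / 4\<rceil>] (mod 4)"
proof -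
  have "finite \<Lambda>" "card \<Lambda> = n" using assms(3) by (simp_all add: orthogonal_array_def)
  then obtain e where e: "bij_betw e \<Lambda> {..<n}"
    using ex_bij_betw_finite_nat[of \<Lambda>] by (auto simp: atLeast0LessThan)
  interpret complete_array n "\<lambda>r i. e (A $$ (r, i))"
    by (rule complete_array_labels[OF assms(3) e assms(1)])
  have "equiparity \<Lambda> (ensemble_square A i j l) \<longleftrightarrow>
      (beats i j \<noteq> beats i l) = (beats j i \<noteq> beats j l) \<and>
      (beats j i \<noteq> beats j l) = (beats l i \<noteq> beats l j)"
    if "i < j" "j < l" "l < n + 1" for i j l
  proof -
    have *: "i \<le> n" "j \<le> n" "l \<le> n" "i \<noteq> j" "i \<noteq> l" "j \<noteq> i" "j \<noteq> l" "l \<noteq> i" "l \<noteq> j"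
      using that by auto
    show ?thesis
      unfolding equiparity_iff[OF assms(3) e that(1,2) *(3)]
        odd_block_inversions_iff[OF *(1,2,3,4,5)] odd_block_inversions_iff[OF *(2,1,3,6,7)]
        odd_block_inversions_iff[OF *(3,1,2,8,9)] ..
  qed
  then have "{(i, j, l). i < j \<and> j < l \<and> l < n + 1 \<and> equiparity \<Lambda> (ensemble_square A i j l)} =
      aligned_triples"
    unfolding aligned_triples_def triples_def by blast
  then show ?thesis
    using card_aligned_triples[OF assms(2) odd_choose_two[OF assms(2)]] by simp
qed

end
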